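(* The minimum value function $F$ and its one-sided derivatives $D^{\pm}F$ satisfy \[ \lim_{\alpha\to\infty}\frac{F(\alpha)}{\alpha}=\lim_{\alpha\to\infty}D^{+}F(\alpha)=\lim_{\alpha\to\infty}D^{-}F(\alpha)=\inf_{x\in Q_{\mathrm{ad}}}\psi(x). \]
   Context: Let $X,Y$ be Banach spaces, $Q_{\mathrm{ad}}\subset X$ a nonempty admissible set, $y^\delta\in Y$ fixed data, and let $\varphi(\cdot,y^\delta):Q_{\mathrm{ad}}\to[0,\infty)$ (fidelity functional) and $\psi:Q_{\mathrm{ad}}\to[0,\infty)$ (regularization functional) be given. For $\alpha>0$ put $J_\alpha(x)=\varphi(x,y^\delta)+\alpha\psi(x)$, and define the minimum value function $F(\alpha)=\inf_{x\in Q_{\mathrm{ad}}}J_\alpha(x)$, $\alpha>0$. The one-sided derivatives are denoted (note the convention: $D^+$ is the derivative from the left, $D^-$ the derivative from the right) \[ D^{+}F(\alpha)=\lim_{h\downarrow 0}\frac{F(\alpha)-F(\alpha-h)}{h},\qquad D^{-}F(\alpha)=\lim_{h\downarrow 0}\frac{F(\alpha+h)-F(\alpha)}{h}; \] both limits exist for every $\alpha>0$ because $F$ is concave. *)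

theory Defs
  imports "HOL-Analysis.Analysis"
begin

definition tikhonov :: "('x \<Rightarrow> 'y \<Rightarrow> real) \<Rightarrow> ('x \<Rightarrow> real) \<Rightarrow> 'y \<Rightarrow> real \<Rightarrow> 'x \<Rightarrow> real"
  where "tikhonov \<phi> \<psi> y \<alpha> x = \<phi> x y + \<alpha> * \<psi> x"

definition min_value ::
  "'x set \<Rightarrow> ('x \<Rightarrow> 'y \<Rightarrow> real) \<Rightarrow> ('x \<Rightarrow> real) \<Rightarrow> 'y \<Rightarrow> real \<Rightarrow> real"
  where "min_value Q \<phi> \<psi> y \<alpha> = (INF x\<in>Q. tikhonov \<phi> \<psi> y \<alpha> x)"

(* Convention: D_plus is the derivative from the left, D_minus the one from the right. *)

definition D_plus :: "(real \<Rightarrow> real) \<Rightarrow> real \<Rightarrow> real"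
  where "D_plus F \<alpha> = Lim (at_right 0) (\<lambda>h. (F \<alpha> - F (\<alpha> - h)) / h)"

definition D_minus :: "(real \<Rightarrow> real) \<Rightarrow> real \<Rightarrow> real"
  where "D_minus F \<alpha> = Lim (at_right 0) (\<lambda>h. (F (\<alpha> + h) - F \<alpha>) / h)"

lemma concave_on_min_value:
  assumes "Q \<noteq> {}"
    and "\<And>x. x \<in> Q \<Longrightarrow> 0 \<le> \<phi> x y"
    and "\<And>x. x \<in> Q \<Longrightarrow> 0 \<le> \<psi> x"
  shows "concave_on {0<..} (min_value Q \<phi> \<psi> y)"
  unfolding concave_on_iff
proof (intro conjI ballI allI impI)
  show "convex {0::real<..}"
    by simp
next
  fix a b u v :: real
  assume ab: "a \<in> {0<..}" "b \<in> {0<..}" and uv: "0 \<le> u" "0 \<le> v" "u + v = 1"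
  have low: "min_value Q \<phi> \<psi> y c \<le> tikhonov \<phi> \<psi> y c x" if "x \<in> Q" "c \<in> {0<..}" for c x
    unfolding min_value_def
  proof (rule cINF_lower)
    show "bdd_below (tikhonov \<phi> \<psi> y c ` Q)"
      using assms that by (intro bdd_belowI2[where m=0]) (simp add: tikhonov_def)
  qed (use that in auto)
  show "u * min_value Q \<phi> \<psi> y a + v * min_value Q \<phi> \<psi> y b
          \<le> min_value Q \<phi> \<psi> y (u *\<^sub>R a + v *\<^sub>R b)"
    unfolding min_value_def[of Q \<phi> \<psi> y "u *\<^sub>R a + v *\<^sub>R b"]
  proof (rule cINF_greatest[OF assms(1)])
    fix x assume x: "x \<in> Q"
    have "u * min_value Q \<phi> \<psi> y a + v * min_value Q \<phi> \<psi> y b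
            \<le> u * tikhonov \<phi> \<psi> y a x + v * tikhonov \<phi> \<psi> y b x"
      by (intro add_mono mult_left_mono low x ab uv)
    also have "\<dots> = (u + v) * \<phi> x y + (u * a + v * b) * \<psi> x"
      by (simp add: tikhonov_def algebra_simps)
    also have "\<dots> = tikhonov \<phi> \<psi> y (u *\<^sub>R a + v *\<^sub>R b) x"
      by (simp add: uv tikhonov_def)
    finally show "u * min_value Q \<phi> \<psi> y a + v * min_value Q \<phi> \<psi> y b
            \<le> tikhonov \<phi> \<psi> y (u *\<^sub>R a + v *\<^sub>R b) x" .
  qed
qed

lemma antimono_bounded_tendsto_at_right:
  fixes g :: "real \<Rightarrow> real"
  assumes "0 < r"
    and anti: "\<And>s t. 0 < s \<Longrightarrow> s < t \<Longrightarrow> t < r \<Longrightarrow> g t \<le> g s"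
    and bound: "\<And>t. 0 < t \<Longrightarrow> t < r \<Longrightarrow> g t \<le> B"
  shows "(g \<longlongrightarrow> (SUP t\<in>{0<..<r}. g t)) (at_right 0)"
proof (rule order_tendstoI)
  have bdd: "bdd_above (g ` {0<..<r})"
    using bound by (intro bdd_aboveI2[where M=B]) auto
  have ne: "{0<..<r} \<noteq> {}"
    using \<open>0 < r\<close> by simp
  fix a
  show "\<forall>\<^sub>F t in at_right 0. g t < a" if "(SUP t\<in>{0<..<r}. g t) < a"
    unfolding eventually_at_right_field
  proof (intro exI[of _ r] conjI allI impI)
    show "g t < a" if t: "0 < t" "t < r" for t
      using cSUP_upper[OF _ bdd, of t] t \<open>(SUP t\<in>{0<..<r}. g t) < a\<close> by simp
  qed fact
  assume "a < (SUP t\<in>{0<..<r}. g t)"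
  then obtain t where t: "0 < t" "t < r" "a < g t"
    using less_cSUP_iff[OF ne bdd] by auto
  then show "\<forall>\<^sub>F s in at_right 0. a < g s"
    unfolding eventually_at_right_field
    by (intro exI[of _ t] conjI allI impI) (auto intro: less_le_trans[OF _ anti])
qed

lemma concave_slope_decreasing:
  fixes F :: "real \<Rightarrow> real"
  assumes "concave_on {0<..} F" "0 < a" "a < b" "b < c"
  shows "(F c - F a) / (c - a) \<le> (F b - F a) / (b - a)"
    and "(F c - F b) / (c - b) \<le> (F c - F a) / (c - a)"
proof -
  have flip: "(- F s - - F t) / (s - t) = - ((F t - F s) / (t - s))" for s t
    using minus_divide_right[of "F t - F s" "t - s"] by simp
  show "(F c - F a) / (c - a) \<le> (F b - F a) / (b - a)"
    and "(F c - F b) / (c - b) \<le> (F c - F a) / (c - a)"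
    using convex_on_slope_le[of "{0<..}" "\<lambda>x. - F x" a c b] assms
    unfolding flip concave_on_def by auto
qed

lemma concave_D_minus_tendsto:
  assumes F: "concave_on {0<..} F" and "0 < \<alpha>"
  shows "((\<lambda>h. (F (\<alpha> + h) - F \<alpha>) / h) \<longlongrightarrow> D_minus F \<alpha>) (at_right 0)"
proof -
  let ?g = "\<lambda>h. (F (\<alpha> + h) - F \<alpha>) / h"
  have lim: "(?g \<longlongrightarrow> (SUP h\<in>{0<..<1}. ?g h)) (at_right 0)"
  proof (rule antimono_bounded_tendsto_at_right)
    show "?g t \<le> ?g s" if "0 < s" "s < t" "t < 1" for s t
      using concave_slope_decreasing(1)[OF F, of \<alpha> "\<alpha> + s" "\<alpha> + t"] that assms by simp
    show "?g t \<le> (F \<alpha> - F (\<alpha> / 2)) / (\<alpha> - \<alpha> / 2)" if "0 < t" "t < 1" for t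
      using concave_slope_decreasing[OF F, of "\<alpha> / 2" \<alpha> "\<alpha> + t"] that assms by simp
  qed simp
  then show ?thesis
    unfolding D_minus_def tendsto_Lim[OF trivial_limit_at_right_real lim] .
qed

lemma concave_D_plus_tendsto:
  assumes F: "concave_on {0<..} F" and "0 < \<alpha>"
  shows "((\<lambda>h. (F \<alpha> - F (\<alpha> - h)) / h) \<longlongrightarrow> D_plus F \<alpha>) (at_right 0)"
proof -
  let ?g = "\<lambda>h. (F \<alpha> - F (\<alpha> - h)) / h"
  have "((\<lambda>h. - ?g h) \<longlongrightarrow> (SUP h\<in>{0<..<\<alpha>}. - ?g h)) (at_right 0)"
  proof (rule antimono_bounded_tendsto_at_right)
    show "- ?g t \<le> - ?g s" if "0 < s" "s < t" "t < \<alpha>" for s t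
      using concave_slope_decreasing(2)[OF F, of "\<alpha> - t" "\<alpha> - s" \<alpha>] that assms by simp
    show "- ?g t \<le> - (F (\<alpha> + 1) - F \<alpha>)" if "0 < t" "t < \<alpha>" for t
      using concave_slope_decreasing[OF F, of "\<alpha> - t" \<alpha> "\<alpha> + 1"] that assms by simp
  qed (use assms in simp)
  from tendsto_minus[OF this]
  have lim: "(?g \<longlongrightarrow> - (SUP h\<in>{0<..<\<alpha>}. - ?g h)) (at_right 0)"
    by simp
  then show ?thesis
    unfolding D_plus_def tendsto_Lim[OF trivial_limit_at_right_real lim] .
qed

end

theory Submission
  imports Defs
begin

text \<open>
  Write \<open>m = inf \<psi>\<close>. Since \<open>\<phi>\<close> is nonnegative, \<open>m \<le> F \<alpha> / \<alpha>\<close>, while testing the infimum with a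
  single admissible \<open>x\<close> gives \<open>F \<alpha> / \<alpha> \<le> \<phi> x y / \<alpha> + \<psi> x\<close>. The fidelity term is washed out as
  \<open>\<alpha>\<close> grows, and \<open>\<psi> x\<close> can be taken as close to \<open>m\<close> as desired; this is the limit of the quotient
  (\<open>min_value_div_tendsto_Inf\<close>).

  The limits of the derivatives follow from this one by concavity alone. The slopes of the
  chords of a concave function decrease to the right, so every chord has at least the asymptotic
  slope \<open>m\<close> (\<open>concave_slope_ge_asymptotic_slope\<close>); hence both one-sided derivatives are at least \<open>m\<close>. Conversely both derivatives at \<open>\<alpha>\<close> are at
  most the slope of the chord over \<open>[\<alpha>/2, \<alpha>]\<close>, which equals
  \<open>2 F(\<alpha>)/\<alpha> - F(\<alpha>/2)/(\<alpha>/2)\<close> and therefore tends to \<open>2 m - m = m\<close>. The derivatives are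
  squeezed between the two bounds.
\<close>

text \<open>
  Keep the left end of a chord fixed and send the right end to infinity: the slope decreases to
  the asymptotic slope.
\<close>

lemma concave_slope_ge_asymptotic_slope:
  fixes F :: "real \<Rightarrow> real"
  assumes F: "concave_on {0<..} F"
    and lim: "((\<lambda>t. F t / t) \<longlongrightarrow> m) at_top"
    and "0 < a" "a < b"
  shows "m \<le> (F b - F a) / (b - a)"
proof (rule tendsto_upperbound)
  have inv: "((\<lambda>t::real. c / t) \<longlongrightarrow> 0) at_top" for c
    by (rule tendsto_divide_0[OF tendsto_const filterlim_at_top_imp_at_infinity[OF filterlim_ident]])
  have "((\<lambda>t. (F t / t - F a / t) / (1 - a / t)) \<longlongrightarrow> (m - 0) / (1 - 0)) at_top"
    by (intro tendsto_intros lim inv) simp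
  moreover have "\<forall>\<^sub>F t in at_top. (F t / t - F a / t) / (1 - a / t) = (F t - F a) / (t - a)"
    using eventually_gt_at_top[of a]
  proof eventually_elim
    case (elim t)
    then show ?case
      using \<open>0 < a\<close> by (simp add: field_simps)
  qed
  ultimately show "((\<lambda>t. (F t - F a) / (t - a)) \<longlongrightarrow> m) at_top"
    by (simp add: tendsto_cong)
  show "\<forall>\<^sub>F t in at_top. (F t - F a) / (t - a) \<le> (F b - F a) / (b - a)"
    using eventually_gt_at_top[of b]
    by eventually_elim (use concave_slope_decreasing(1)[OF F \<open>0 < a\<close> \<open>a < b\<close>] in auto)
qed simp

lemma concave_D_minus_le_slope:
  assumes F: "concave_on {0<..} F" and "0 < a" "a < b"
  shows "D_minus F b \<le> (F b - F a) / (b - a)"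
proof (rule tendsto_upperbound[OF concave_D_minus_tendsto[OF F]])
  show "\<forall>\<^sub>F h in at_right 0. (F (b + h) - F b) / h \<le> (F b - F a) / (b - a)"
    using eventually_at_right_less[of 0]
  proof eventually_elim
    case (elim h)
    then show ?case
      using concave_slope_decreasing[OF F \<open>0 < a\<close> \<open>a < b\<close>, of "b + h"] by simp
  qed
qed (use assms in auto)

lemma concave_D_plus_le_slope:
  assumes F: "concave_on {0<..} F" and "0 < a" "a < b"
  shows "D_plus F b \<le> (F b - F a) / (b - a)"
proof (rule tendsto_upperbound[OF concave_D_plus_tendsto[OF F]])
  show "\<forall>\<^sub>F h in at_right 0. (F b - F (b - h)) / h \<le> (F b - F a) / (b - a)"
    unfolding eventually_at_right_field
  proof (intro exI[of _ "b - a"] conjI allI impI)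
    show "(F b - F (b - h)) / h \<le> (F b - F a) / (b - a)" if "0 < h" "h < b - a" for h
      using concave_slope_decreasing(2)[OF F \<open>0 < a\<close>, of "b - h" b] that by simp
  qed (use assms in simp)
qed (use assms in auto)

lemma concave_one_sided_derivatives_tendsto:
  fixes F :: "real \<Rightarrow> real"
  assumes F: "concave_on {0<..} F"
    and lim: "((\<lambda>t. F t / t) \<longlongrightarrow> m) at_top"
  shows "(D_plus F \<longlongrightarrow> m) at_top" and "(D_minus F \<longlongrightarrow> m) at_top"
proof -
  let ?chord = "\<lambda>t. (F t - F (t / 2)) / (t - t / 2)"
  have "filterlim (\<lambda>t::real. 1 / 2 * t) at_top at_top"
    by (rule filterlim_tendsto_pos_mult_at_top[OF tendsto_const _ filterlim_ident]) simp
  then have "((\<lambda>t. F (t / 2) / (t / 2)) \<longlongrightarrow> m) at_top"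
    using filterlim_compose[OF lim] by fastforce
  with lim have "((\<lambda>t. 2 * (F t / t) - F (t / 2) / (t / 2)) \<longlongrightarrow> 2 * m - m) at_top"
    by (intro tendsto_intros)
  moreover have "2 * (F t / t) - F (t / 2) / (t / 2) = ?chord t" for t
    by (cases "t = 0") (simp_all add: field_simps)
  ultimately have chord: "(?chord \<longlongrightarrow> m) at_top"
    by simp
  have slope: "m \<le> (F b - F a) / (b - a)" if "0 < a" "a < b" for a b
    using concave_slope_ge_asymptotic_slope[OF F lim that] .
  show "(D_plus F \<longlongrightarrow> m) at_top"
  proof (rule tendsto_sandwich[OF _ _ tendsto_const chord])
    show "\<forall>\<^sub>F t in at_top. m \<le> D_plus F t"
      using eventually_gt_at_top[of 0]
    proof eventually_elim
      case (elim t)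
      show ?case
      proof (rule tendsto_lowerbound[OF concave_D_plus_tendsto[OF F elim]])
        show "\<forall>\<^sub>F h in at_right 0. m \<le> (F t - F (t - h)) / h"
          unfolding eventually_at_right_field
        proof (intro exI[of _ t] conjI allI impI)
          show "m \<le> (F t - F (t - h)) / h" if "0 < h" "h < t" for h
            using slope[of "t - h" t] that by simp
        qed (use elim in simp)
      qed simp
    qed
    show "\<forall>\<^sub>F t in at_top. D_plus F t \<le> ?chord t"
      using eventually_gt_at_top[of 0]
      by eventually_elim (rule concave_D_plus_le_slope[OF F], auto)
  qed
  show "(D_minus F \<longlongrightarrow> m) at_top"
  proof (rule tendsto_sandwich[OF _ _ tendsto_const chord])
    show "\<forall>\<^sub>F t in at_top. m \<le> D_minus F t"
      using eventually_gt_at_top[of 0]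
    proof eventually_elim
      case (elim t)
      show ?case
      proof (rule tendsto_lowerbound[OF concave_D_minus_tendsto[OF F elim]])
        show "\<forall>\<^sub>F h in at_right 0. m \<le> (F (t + h) - F t) / h"
          using eventually_at_right_less[of 0]
        proof eventually_elim
          case (elim h)
          then show ?case
            using slope[of t "t + h"] \<open>0 < t\<close> by simp
        qed
      qed simp
    qed
    show "\<forall>\<^sub>F t in at_top. D_minus F t \<le> ?chord t"
      using eventually_gt_at_top[of 0]
      by eventually_elim (rule concave_D_minus_le_slope[OF F], auto)
  qed
qed

lemma min_value_div_tendsto_Inf:
  assumes ne: "Q \<noteq> {}"
    and \<phi>: "\<And>x. x \<in> Q \<Longrightarrow> 0 \<le> \<phi> x y"
    and \<psi>: "\<And>x. x \<in> Q \<Longrightarrow> 0 \<le> \<psi> x"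
  shows "((\<lambda>\<alpha>. min_value Q \<phi> \<psi> y \<alpha> / \<alpha>) \<longlongrightarrow> (INF x\<in>Q. \<psi> x)) at_top"
proof (rule order_tendstoI)
  let ?m = "INF x\<in>Q. \<psi> x"
  have bdd: "bdd_below (\<psi> ` Q)"
    using \<psi> by (rule bdd_belowI2)
  have lower: "?m \<le> min_value Q \<phi> \<psi> y \<alpha> / \<alpha>" if "0 < \<alpha>" for \<alpha>
  proof -
    have "\<alpha> * ?m \<le> min_value Q \<phi> \<psi> y \<alpha>"
      unfolding min_value_def
    proof (rule cINF_greatest[OF ne])
      fix x assume x: "x \<in> Q"
      have "\<alpha> * ?m \<le> \<alpha> * \<psi> x"
        using cINF_lower[OF bdd x] that by simp
      then show "\<alpha> * ?m \<le> tikhonov \<phi> \<psi> y \<alpha> x"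
        using \<phi>[OF x] by (simp add: tikhonov_def)
    qed
    with that show ?thesis
      by (simp add: pos_le_divide_eq mult.commute)
  qed
  have upper: "min_value Q \<phi> \<psi> y \<alpha> / \<alpha> \<le> \<phi> x y / \<alpha> + \<psi> x" if "x \<in> Q" "0 < \<alpha>" for x \<alpha>
  proof -
    have "min_value Q \<phi> \<psi> y \<alpha> \<le> tikhonov \<phi> \<psi> y \<alpha> x"
      unfolding min_value_def
    proof (rule cINF_lower)
      show "bdd_below (tikhonov \<phi> \<psi> y \<alpha> ` Q)"
        using \<phi> \<psi> that by (intro bdd_belowI2[where m = 0]) (simp add: tikhonov_def)
    qed fact
    with \<open>0 < \<alpha>\<close> show ?thesis
      by (simp add: tikhonov_def field_simps)
  qed
  fix c
  show "\<forall>\<^sub>F \<alpha> in at_top. c < min_value Q \<phi> \<psi> y \<alpha> / \<alpha>" if "c < ?m"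
    using eventually_gt_at_top[of 0]
    by eventually_elim (use lower that in force)
  assume "?m < c"
  then obtain x where x: "x \<in> Q" "\<psi> x < c"
    using cINF_less_iff[OF ne bdd] by auto
  have "((\<lambda>\<alpha>. \<phi> x y / \<alpha> + \<psi> x) \<longlongrightarrow> 0 + \<psi> x) at_top"
    by (intro tendsto_add tendsto_const tendsto_divide_0[OF tendsto_const]
        filterlim_at_top_imp_at_infinity[OF filterlim_ident])
  with x(2) have "\<forall>\<^sub>F \<alpha> in at_top. \<phi> x y / \<alpha> + \<psi> x < c"
    by (intro order_tendstoD(2)) auto
  then show "\<forall>\<^sub>F \<alpha> in at_top. min_value Q \<phi> \<psi> y \<alpha> / \<alpha> < c"
    using eventually_gt_at_top[of 0]
    by eventually_elim (use upper[OF x(1)] in force)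
qed

theorem proposition2:
  fixes Q :: "'x::banach set" and y :: "'y::banach"
    and \<phi> :: "'x \<Rightarrow> 'y \<Rightarrow> real" and \<psi> :: "'x \<Rightarrow> real"
    and F :: "real \<Rightarrow> real"
  assumes "Q \<noteq> {}"
    and "\<And>x. x \<in> Q \<Longrightarrow> 0 \<le> \<phi> x y"
    and "\<And>x. x \<in> Q \<Longrightarrow> 0 \<le> \<psi> x"
  defines "F \<equiv> min_value Q \<phi> \<psi> y"
  shows "((\<lambda>\<alpha>. F \<alpha> / \<alpha>) \<longlongrightarrow> (INF x\<in>Q. \<psi> x)) at_top
       \<and> (D_plus F \<longlongrightarrow> (INF x\<in>Q. \<psi> x)) at_top
       \<and> (D_minus F \<longlongrightarrow> (INF x\<in>Q. \<psi> x)) at_top"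
proof -
  have concave: "concave_on {0<..} F"
    unfolding F_def using assms(1-3) by (rule concave_on_min_value)
  have quotient: "((\<lambda>\<alpha>. F \<alpha> / \<alpha>) \<longlongrightarrow> (INF x\<in>Q. \<psi> x)) at_top"
    unfolding F_def using assms(1-3) by (rule min_value_div_tendsto_Inf)
  show ?thesis
    using quotient concave_one_sided_derivatives_tendsto[OF concave quotient] by blast
qed

end
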